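(* Let $\mathcal{X}=\mathbb{F}_q$ be a finite field of size $q$, let $K\ge 1$, let $\mathcal{Y}_1,\dots,\mathcal{Y}_K$ be arbitrary finite sets, and let $(X,Y_1,\dots,Y_K)$ be random variables with joint distribution $P_{X,Y_1,\dots,Y_K}$ on $\mathcal{X}\times\mathcal{Y}_1\times\cdots\times\mathcal{Y}_K$. For every $n$, let $(X^{1:n},Y_1^{1:n},\dots,Y_K^{1:n})$ denote $n$ independent copies of $(X,Y_1,\dots,Y_K)$. Then for any $\epsilon>0$ and $\delta>0$ there are (positive) integers $t$ and $m_0$ such that for any integer $m\ge m_0$, with $n=t2^m$, there exist a (rate) number $R_{[K]}$, an encoder $$f_{[K]}^{n}:\mathcal{X}^n\to\mathcal{X}^{nR_{[K]}}$$ and $K$ decoders $$g_{[K]}^{n,k}:\mathcal{X}^{nR_{[K]}}\times\mathcal{Y}_k^n\to\mathcal{X}^n,\qquad 1\le k\le K,$$ such that the rate satisfies $$0<R_{[K]}-\max_{1\le k\le K}H_q(X|Y_k)<\delta$$ and the probability of error satisfies $$P_{[K]}^{n,k}:=\Pr\big[X^{1:n}\neq g_{[K]}^{n,k}\big(f_{[K]}^{n}(X^{1:n}),Y_k^{1:n}\big)\big]<\epsilon$$ for all $1\le k\le K$.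
   Context: Notation: $X^{1:n}=(X^1,\dots,X^n)$, and similarly for other sequences. The conditional entropy to base $q$ is $H_q(X|Y)=-\sum_{x\in\mathcal{X},y\in\mathcal{Y}}P_{X,Y}(x,y)\log_q P_{X|Y}(x|y)$ (with the usual convention that terms with $P_{X,Y}(x,y)=0$ are zero). The rate $R_{[K]}$ is the ratio of the length of the encoded sequence (in symbols of $\mathcal{X}$) to $n$, so $nR_{[K]}$ is a nonnegative integer; $R_{[K]}$ may depend on $m$. The encoder and the decoders may depend on the joint distribution $P_{X,Y_1,\dots,Y_K}$; a single encoder serves all $K$ decoders, and the side information $Y_k^{1:n}$ is available only to decoder $k$. *)

theory Defs
  imports "HOL-Probability.Probability" "HOL-Library.NList"
begin

text \<open>
  The joint law of \<open>(X, Y\<^sub>1, \<dots>, Y\<^sub>K)\<close> is a pmf on pairs \<open>(x, y)\<close>, where \<open>y k\<close> is the value of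
  \<open>Y\<^sub>k\<close> for \<open>k \<in> {1..K}\<close>. Only one type carries the side information; the alphabets are arbitrary
  finite subsets \<open>\<Y> k\<close> of it. Sequences of length \<open>n\<close> over \<open>A\<close> are the lists in \<open>nlists n A\<close>.
\<close>

definition joint_law_on ::
    "nat \<Rightarrow> (nat \<Rightarrow> 'y set) \<Rightarrow> ('x \<times> (nat \<Rightarrow> 'y)) pmf \<Rightarrow> bool" where
  "joint_law_on K \<Y> P \<longleftrightarrow> set_pmf P \<subseteq> UNIV \<times> (\<Pi>\<^sub>E k\<in>{1..K}. \<Y> k)"

definition law_X_Y :: "nat \<Rightarrow> ('x \<times> (nat \<Rightarrow> 'y)) pmf \<Rightarrow> ('x \<times> 'y) pmf" where
  "law_X_Y k P = map_pmf (\<lambda>(x, y). (x, y k)) P"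

definition cond_prob_pmf :: "('x \<times> 'y) pmf \<Rightarrow> 'x \<Rightarrow> 'y \<Rightarrow> real" where
  "cond_prob_pmf J x y = pmf J (x, y) / pmf (map_pmf snd J) y"

text \<open>Terms with \<open>pmf J (x, y) = 0\<close> vanish because of the factor \<open>pmf J (x, y)\<close>.\<close>

definition cond_entropy_pmf ::
    "real \<Rightarrow> 'x set \<Rightarrow> 'y set \<Rightarrow> ('x \<times> 'y) pmf \<Rightarrow> real" where
  "cond_entropy_pmf b A B J =
     - (\<Sum>(x, y)\<in>A \<times> B. pmf J (x, y) * log b (cond_prob_pmf J x y))"

definition decoding_error ::
    "('x \<times> (nat \<Rightarrow> 'y)) pmf \<Rightarrow> nat \<Rightarrow> ('x list \<Rightarrow> 'x list) \<Rightarrow>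
     ('x list \<times> 'y list \<Rightarrow> 'x list) \<Rightarrow> nat \<Rightarrow> real" where
  "decoding_error P n f g k =
     measure_pmf.prob (replicate_pmf n P)
       {\<omega>. map fst \<omega> \<noteq> g (f (map fst \<omega>), map (\<lambda>(x, y). y k) \<omega>)}"

end

theory Submission imports Defs begin

text \<open>
  Random binning suffices, already with \<open>t = 1\<close>. Colour all words of length \<open>n\<close> independently and
  uniformly with words of length \<open>l \<approx> n (H + \<delta>/2)\<close>, where \<open>H\<close> is the largest of the conditional
  entropies. Decoder \<open>k\<close> looks for a word of the received colour whose conditional probability
  given its side information is at least \<open>q powr (- n (H + \<delta>/4))\<close>. By Chebyshev's inequality the
  source word qualifies with high probability; since at most \<open>q powr (n (H + \<delta>/4))\<close> words qualify,
  the expected number of wrong ones of the same colour is at most \<open>q powr (- n \<delta>/4)\<close>. The sum of the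
  \<open>K\<close> error probabilities thus tends to \<open>0\<close> on average, so some single colouring serves all decoders.
\<close>

section \<open>Independent copies\<close>

lemma replicate_pmf_Suc_pair:
  "replicate_pmf (Suc n) p = map_pmf (\<lambda>(x, xs). x # xs) (pair_pmf p (replicate_pmf n p))"
  by (simp add: map_pmf_def pair_pmf_def bind_assoc_pmf bind_return_pmf)

lemma map_replicate_pmf:
  "map_pmf (map f) (replicate_pmf n p) = replicate_pmf n (map_pmf f p)"
proof (induction n)
  case (Suc n)
  show ?case
    by (simp add: replicate_pmf_Suc_pair map_pmf_comp case_prod_beta flip: Suc map_pair
        del: replicate_pmf.simps)
qed simp

lemma finite_set_replicate_pmf:
  assumes "finite (set_pmf p)"
  shows "finite (set_pmf (replicate_pmf n p))"
  using finite_lists_length_eq[OF assms, of n]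
  by (simp add: set_replicate_pmf in_lists_conv_set subset_eq conj_commute)

lemma expectation_pair_pmf_mult:
  fixes f :: "'a \<Rightarrow> real" and g :: "'b \<Rightarrow> real"
  assumes "finite (set_pmf p)" "finite (set_pmf r)"
  shows "measure_pmf.expectation (pair_pmf p r) (\<lambda>z. f (fst z) * g (snd z)) =
         measure_pmf.expectation p f * measure_pmf.expectation r g"
proof -
  have "measure_pmf.expectation (pair_pmf p r) (\<lambda>z. f (fst z) * g (snd z)) =
        (\<Sum>z\<in>set_pmf p \<times> set_pmf r. f (fst z) * g (snd z) * pmf (pair_pmf p r) z)"
    by (rule integral_measure_pmf_real) (use assms in auto)
  also have "\<dots> = (\<Sum>x\<in>set_pmf p. \<Sum>y\<in>set_pmf r. (f x * pmf p x) * (g y * pmf r y))"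
    unfolding sum.cartesian_product
    by (rule sum.cong) (auto simp: pmf_pair)
  also have "\<dots> = (\<Sum>x\<in>set_pmf p. f x * pmf p x) * (\<Sum>y\<in>set_pmf r. g y * pmf r y)"
    by (simp add: sum_product)
  also have "\<dots> = measure_pmf.expectation p f * measure_pmf.expectation r g"
    using assms by (simp add: integral_measure_pmf_real[of "set_pmf p"]
        integral_measure_pmf_real[of "set_pmf r"])
  finally show ?thesis .
qed

text \<open>Variances of independent centred terms add. Splitting off the first letter and expanding
  the square leaves the cross term \<open>h (fst z) * ?S (snd z)\<close>, whose expectation
  factorises and vanishes because \<open>h\<close> has mean zero.\<close>

lemma replicate_pmf_centered_moments:
  fixes h :: "'a \<Rightarrow> real"
  assumes fin: "finite (set_pmf p)" and mean: "measure_pmf.expectation p h = 0"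
  shows "measure_pmf.expectation (replicate_pmf n p) (\<lambda>xs. sum_list (map h xs)) = 0 \<and>
         measure_pmf.expectation (replicate_pmf n p) (\<lambda>xs. (sum_list (map h xs))\<^sup>2) =
           real n * measure_pmf.expectation p (\<lambda>x. (h x)\<^sup>2)"
proof (induction n)
  case 0
  then show ?case by simp
next
  case (Suc n)
  let ?r = "replicate_pmf n p"
  let ?S = "\<lambda>xs. sum_list (map h xs)"
  let ?Q = "pair_pmf p ?r"
  have finr: "finite (set_pmf ?r)" by (rule finite_set_replicate_pmf[OF fin])
  have int: "integrable ?Q u" for u :: "'a \<times> 'a list \<Rightarrow> real"
    by (rule integrable_measure_pmf_finite) (use fin finr in auto)
  have cross: "measure_pmf.expectation ?Q (\<lambda>z. h (fst z) * ?S (snd z)) = 0"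
    using expectation_pair_pmf_mult[OF fin finr, of h ?S] mean by simp
  have "measure_pmf.expectation (replicate_pmf (Suc n) p) ?S =
        measure_pmf.expectation ?Q (\<lambda>z. h (fst z) + ?S (snd z))"
    by (simp add: replicate_pmf_Suc_pair case_prod_beta del: replicate_pmf.simps)
  also have "\<dots> = 0"
    using Suc mean expectation_pair_pmf_snd[of p ?r ?S] by (simp add: int)
  finally have 1: "measure_pmf.expectation (replicate_pmf (Suc n) p) ?S = 0" .
  have "measure_pmf.expectation (replicate_pmf (Suc n) p) (\<lambda>xs. (?S xs)\<^sup>2) =
        measure_pmf.expectation ?Q
          (\<lambda>z. (h (fst z))\<^sup>2 + (?S (snd z))\<^sup>2 + 2 * (h (fst z) * ?S (snd z)))"
    by (simp add: replicate_pmf_Suc_pair case_prod_beta power2_sum mult.assoc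
          del: replicate_pmf.simps)
  also have "\<dots> = measure_pmf.expectation ?Q (\<lambda>z. (h (fst z))\<^sup>2) +
      measure_pmf.expectation ?Q (\<lambda>z. (?S (snd z))\<^sup>2) +
      2 * measure_pmf.expectation ?Q (\<lambda>z. h (fst z) * ?S (snd z))"
    by (simp add: int del: expectation_pair_pmf_fst expectation_pair_pmf_snd)
  also have "\<dots> = real (Suc n) * measure_pmf.expectation p (\<lambda>x. (h x)\<^sup>2)"
    using Suc cross expectation_pair_pmf_fst[of p ?r "\<lambda>x. (h x)\<^sup>2"]
      expectation_pair_pmf_snd[of p ?r "\<lambda>xs. (?S xs)\<^sup>2"]
    by (simp add: algebra_simps)
  finally show ?case using 1 by blast
qed

text \<open>One-sided Chebyshev: the event implies that the square of the sum is at least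
  \<open>(real n * \<gamma>)\<^sup>2\<close>, and Markov's inequality applies to that
  square.\<close>

lemma replicate_pmf_weak_law:
  fixes h :: "'a \<Rightarrow> real"
  assumes fin: "finite (set_pmf p)" and mean: "measure_pmf.expectation p h = 0"
    and "\<gamma> > 0" "n > 0"
  shows "measure_pmf.prob (replicate_pmf n p) {xs. sum_list (map h xs) \<ge> real n * \<gamma>} \<le>
         measure_pmf.expectation p (\<lambda>x. (h x)\<^sup>2) / (real n * \<gamma>\<^sup>2)"
proof -
  let ?r = "replicate_pmf n p"
  let ?S = "\<lambda>xs. sum_list (map h xs)"
  have pos: "real n * \<gamma> > 0" using assms by simp
  have int: "integrable ?r (\<lambda>xs. (?S xs)\<^sup>2)"
    by (intro integrable_measure_pmf_finite finite_set_replicate_pmf fin)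
  have "measure_pmf.prob ?r {xs. ?S xs \<ge> real n * \<gamma>} \<le>
        measure_pmf.prob ?r {xs. (?S xs)\<^sup>2 \<ge> (real n * \<gamma>)\<^sup>2}"
    by (rule measure_pmf.finite_measure_mono) (use pos in \<open>auto intro!: power_mono\<close>)
  also have "\<dots> \<le> measure_pmf.expectation ?r (\<lambda>xs. (?S xs)\<^sup>2) / (real n * \<gamma>)\<^sup>2"
    using integral_Markov_inequality_measure[OF int, of "{}" "(real n * \<gamma>)\<^sup>2"] pos
    by (simp add: zero_less_mult_iff)
  also have "\<dots> = measure_pmf.expectation p (\<lambda>x. (h x)\<^sup>2) / (real n * \<gamma>\<^sup>2)"
    using replicate_pmf_centered_moments[OF fin mean, of n] assms
    by (simp add: power2_eq_square)
  finally show ?thesis .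
qed

section \<open>Random binning\<close>

text \<open>The probabilistic method: it turns a bound on the average over random colourings into
  one concrete colouring.\<close>

lemma ex_less_of_expectation_less:
  fixes g :: "'a \<Rightarrow> real"
  assumes "finite (set_pmf p)" "measure_pmf.expectation p g < c"
  shows "\<exists>x\<in>set_pmf p. g x < c"
proof (rule ccontr)
  assume "\<not> ?thesis"
  then have "AE x in measure_pmf p. c \<le> g x"
    by (auto simp: AE_measure_pmf_iff not_less)
  then have "c \<le> measure_pmf.expectation p g"
    using assms(1) by (intro measure_pmf.integral_ge_const integrable_measure_pmf_finite)
  with assms(2) show False by simp
qed

text \<open>The colour of \<open>x\<close> is drawn last. With all other colours fixed, a collision
  forces it to equal the single value \<open>g x'\<close>. Only an inequality holds in general,
  since for \<open>x'\<close> outside \<open>A\<close> that value is the default \<open>d\<close>,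
  which may lie outside \<open>B\<close>.\<close>

lemma Pi_pmf_uniform_collision:
  assumes A: "finite A" "x \<in> A" "x' \<noteq> x" and B: "finite B" "B \<noteq> {}"
  shows "measure_pmf.prob (Pi_pmf A d (\<lambda>_. pmf_of_set B)) {f. f x' = f x} \<le> 1 / real (card B)"
proof -
  let ?u = "pmf_of_set B"
  let ?G = "Pi_pmf (A - {x}) d (\<lambda>_. ?u)"
  have eq: "Pi_pmf A d (\<lambda>_. ?u) =
      bind_pmf ?G (\<lambda>g. bind_pmf ?u (\<lambda>y. return_pmf (g(x := y))))"
    using Pi_pmf_insert'[of "A - {x}" x d "\<lambda>_. ?u"] A
    by (subst bind_commute_pmf) (simp add: insert_absorb)
  have single: "emeasure (bind_pmf ?u (\<lambda>y. return_pmf (g(x := y)))) {f. f x' = f x} \<le>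
      ennreal (1 / real (card B))" for g
  proof -
    have "bind_pmf ?u (\<lambda>y. return_pmf (g(x := y))) = map_pmf (\<lambda>y. g(x := y)) ?u"
      by (simp add: map_pmf_def)
    moreover have "(\<lambda>y. g(x := y)) -` {f. f x' = f x} = {g x'}"
      using A(3) by auto
    ultimately have "emeasure (bind_pmf ?u (\<lambda>y. return_pmf (g(x := y)))) {f. f x' = f x} =
        ennreal (pmf ?u (g x'))"
      by (simp add: emeasure_pmf_single)
    also have "\<dots> \<le> ennreal (1 / real (card B))"
      using B by (intro ennreal_leI) (auto simp: indicator_def)
    finally show ?thesis .
  qed
  have "emeasure (Pi_pmf A d (\<lambda>_. ?u)) {f. f x' = f x} \<le> (\<integral>\<^sup>+g. ennreal (1 / real (card B)) \<partial>?G)"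
    unfolding eq emeasure_bind_pmf[of ?G] by (intro nn_integral_mono single)
  also have "\<dots> = ennreal (1 / real (card B))" by simp
  finally show ?thesis
    by (simp add: measure_pmf.emeasure_eq_measure)
qed

text \<open>Here \<open>s\<close> is the received colour and \<open>T x y\<close> says that
  \<open>x\<close> is plausible given the side information \<open>y\<close>. The fallback
  \<open>d\<close> keeps the output a legal word when no candidate qualifies.\<close>

definition bin_decode :: "'a set \<Rightarrow> 'a \<Rightarrow> ('a \<Rightarrow> 'b \<Rightarrow> bool) \<Rightarrow> ('a \<Rightarrow> 'c) \<Rightarrow> 'c \<Rightarrow> 'b \<Rightarrow> 'a" where
  "bin_decode A d T f s y =
     (if \<exists>x\<in>A. f x = s \<and> T x y then SOME x. x \<in> A \<and> f x = s \<and> T x y else d)"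

lemma bin_decode_in:
  assumes "d \<in> A"
  shows "bin_decode A d T f s y \<in> A"
proof (cases "\<exists>x\<in>A. f x = s \<and> T x y")
  case True
  then have "\<exists>x. x \<in> A \<and> f x = s \<and> T x y" by blast
  from someI_ex[OF this] True show ?thesis by (simp add: bin_decode_def)
next
  case False
  then show ?thesis unfolding bin_decode_def using assms by (simp only: if_False)
qed

lemma bin_decode_correct:
  assumes "x \<in> A" "T x y" "\<And>x'. x' \<in> A \<Longrightarrow> T x' y \<Longrightarrow> f x' = f x \<Longrightarrow> x' = x"
  shows "bin_decode A d T f (f x) y = x"
proof -
  have "(SOME x'. x' \<in> A \<and> f x' = f x \<and> T x' y) = x"
    by (rule some_equality) (use assms in auto)
  then show ?thesis using assms(1,2) by (auto simp: bin_decode_def)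
qed

text \<open>For a fixed pair \<open>z\<close> the average is taken over colourings. If
  \<open>T\<close> fails at \<open>z\<close>, the error probability is bounded by 1. Otherwise an
  error forces the true word to share its colour with another plausible word; there are at most
  \<open>N\<close> of these, each colliding with probability at most \<open>1 / card B\<close>.
  Averaging over \<open>z\<close> gives the two terms.\<close>

lemma expected_binning_error:
  fixes Q :: "('a \<times> 'b) pmf" and T :: "'a \<Rightarrow> 'b \<Rightarrow> bool" and B :: "'c set" and N :: real
  assumes finQ: "finite (set_pmf Q)" and A: "finite A" and QA: "fst ` set_pmf Q \<subseteq> A"
    and B: "finite B" "B \<noteq> {}"
    and N: "\<And>y. y \<in> snd ` set_pmf Q \<Longrightarrow> card {x\<in>A. T x y} \<le> N"
  shows "measure_pmf.expectation (Pi_pmf A b (\<lambda>_. pmf_of_set B))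
           (\<lambda>f. measure_pmf.prob Q {z. bin_decode A d T f (f (fst z)) (snd z) \<noteq> fst z}) \<le>
         measure_pmf.prob Q {z. \<not> T (fst z) (snd z)} + N / card B"
proof -
  let ?F = "Pi_pmf A b (\<lambda>_. pmf_of_set B)"
  define E where "E = (\<lambda>f :: 'a \<Rightarrow> 'c. {z. bin_decode A d T f (f (fst z)) (snd z) \<noteq> fst z})"
  have prob_sum: "measure_pmf.prob Q S = (\<Sum>z\<in>set_pmf Q. indicator S z * pmf Q z)" for S
    using integral_measure_pmf_real[OF finQ, of Q "indicator S :: _ \<Rightarrow> real"] by simp
  have finF: "finite (set_pmf ?F)"
    using A B by (auto simp: set_Pi_pmf intro!: finite_PiE_dflt)
  have bound: "measure_pmf.prob ?F {f. z \<in> E f} \<le>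
      indicator {z. \<not> T (fst z) (snd z)} z + N / card B" if z: "z \<in> set_pmf Q" for z
  proof -
    obtain x y where xy: "z = (x, y)" by (cases z)
    have x: "x \<in> A" using z QA xy by force
    have Ny: "card {x\<in>A. T x y} \<le> N" using N z xy by force
    have N0: "0 \<le> N / card B" using Ny by (intro divide_nonneg_nonneg) auto
    show ?thesis
    proof (cases "T x y")
      case False
      then have "indicator {z. \<not> T (fst z) (snd z)} z = (1 :: real)" by (simp add: xy)
      then show ?thesis
        using measure_pmf.prob_le_1[of ?F "{f. z \<in> E f}"] N0 by linarith
    next
      case True
      let ?W = "{x\<in>A. T x y} - {x}"
      have "{f. z \<in> E f} \<subseteq> (\<Union>x'\<in>?W. {f. f x' = f x})"
      proof (rule subsetI, rule ccontr)
        fix f assume f: "f \<in> {f. z \<in> E f}" "f \<notin> (\<Union>x'\<in>?W. {f. f x' = f x})"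
        have "bin_decode A d T f (f x) y = x"
          by (rule bin_decode_correct[OF x]) (use True f(2) in auto)
        with f(1) show False by (simp add: E_def xy)
      qed
      then have "measure_pmf.prob ?F {f. z \<in> E f} \<le>
          measure_pmf.prob ?F (\<Union>x'\<in>?W. {f. f x' = f x})"
        by (intro measure_pmf.finite_measure_mono) auto
      also have "\<dots> \<le> (\<Sum>x'\<in>?W. measure_pmf.prob ?F {f. f x' = f x})"
        by (intro measure_pmf.finite_measure_subadditive_finite) (use A in auto)
      also have "\<dots> \<le> (\<Sum>x'\<in>?W. 1 / real (card B))"
        by (intro sum_mono Pi_pmf_uniform_collision) (use A B x in auto)
      also have "\<dots> = card ?W / card B" by simp
      also have "\<dots> \<le> N / card B"
      proof (rule divide_right_mono)
        have "card ?W \<le> card {x\<in>A. T x y}" using A by (intro card_mono) auto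
        then show "real (card ?W) \<le> N" using Ny by linarith
      qed simp
      finally show ?thesis by (simp add: indicator_def)
    qed
  qed
  have "measure_pmf.expectation ?F (\<lambda>f. measure_pmf.prob Q (E f)) =
        measure_pmf.expectation ?F (\<lambda>f. \<Sum>z\<in>set_pmf Q. indicator (E f) z * pmf Q z)"
    by (simp only: prob_sum)
  \<comment> \<open>The two averages are interchanged, so that the bound for a fixed
    \<open>z\<close> and a random colouring can be used.\<close>
  also have "\<dots> = (\<Sum>z\<in>set_pmf Q. measure_pmf.expectation ?F (\<lambda>f. indicator {f. z \<in> E f} f * pmf Q z))"
    by (subst Bochner_Integration.integral_sum)
       (auto intro!: integrable_measure_pmf_finite finF sum.cong Bochner_Integration.integral_cong
          simp: indicator_def)
  also have "\<dots> = (\<Sum>z\<in>set_pmf Q. measure_pmf.prob ?F {f. z \<in> E f} * pmf Q z)"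
    by simp
  also have "\<dots> \<le> (\<Sum>z\<in>set_pmf Q. (indicator {z. \<not> T (fst z) (snd z)} z + N / card B) * pmf Q z)"
    by (intro sum_mono mult_right_mono bound) auto
  also have "\<dots> = measure_pmf.prob Q {z. \<not> T (fst z) (snd z)} + N / card B"
    by (simp only: distrib_right sum.distrib prob_sum flip: sum_distrib_left)
       (simp add: sum_pmf_eq_1 finQ)
  finally show ?thesis unfolding E_def .
qed

section \<open>Conditional probabilities of words\<close>

text \<open>The sum over words factorises letter by letter. Weights of total at most 1 are allowed
  because \<open>cond_prob_pmf J x y\<close> is 0 for every \<open>x\<close> when \<open>y\<close>
  has probability zero.\<close>

lemma sum_prod_list_nlists_le_1:
  fixes w :: "'a :: finite \<Rightarrow> 'b \<Rightarrow> real"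
  assumes nonneg: "\<And>x y. w x y \<ge> 0" and le: "\<And>y. (\<Sum>x\<in>UNIV. w x y) \<le> 1"
  shows "(\<Sum>xs\<in>nlists (length ys) UNIV. prod_list (map2 w xs ys)) \<le> 1"
proof (induction ys)
  case Nil
  then show ?case by simp
next
  case (Cons y ys)
  let ?n = "length ys"
  have eq: "nlists (length (y # ys)) (UNIV :: 'a set) = (\<lambda>(x, xs). x # xs) ` (UNIV \<times> nlists ?n UNIV)"
    by (auto simp: nlists_Suc)
  have "(\<Sum>xs\<in>nlists (length (y # ys)) UNIV. prod_list (map2 w xs (y # ys))) =
        (\<Sum>z\<in>UNIV \<times> nlists ?n UNIV. w (fst z) y * prod_list (map2 w (snd z) ys))"
    unfolding eq by (subst sum.reindex) (auto simp: inj_on_def case_prod_beta)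
  also have "\<dots> = (\<Sum>x\<in>UNIV. w x y) * (\<Sum>xs\<in>nlists ?n UNIV. prod_list (map2 w xs ys))"
    by (simp add: sum_product sum.cartesian_product case_prod_beta)
  also have "\<dots> \<le> 1 * 1"
    by (intro mult_mono le Cons.IH sum_nonneg prod_list_nonneg) (auto simp: nonneg)
  finally show ?case by simp
qed

lemma finite_nlists_UNIV: "finite (nlists n (UNIV :: 'a :: finite set))"
  unfolding nlists_def conj_commute[of "length _ = n"] by (rule finite_lists_length_eq) (rule finite)

lemma card_nlists_UNIV: "card (nlists n (UNIV :: 'a :: finite set)) = CARD('a) ^ n"
  unfolding nlists_def conj_commute[of "length _ = n"] by (rule card_lists_length_eq) (rule finite)

text \<open>Each counted word contributes at least \<open>c\<close> to a total weight of at most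
  1.\<close>

lemma card_likely_words_le:
  fixes w :: "'a :: finite \<Rightarrow> 'b \<Rightarrow> real"
  assumes nonneg: "\<And>x y. w x y \<ge> 0" and le: "\<And>y. (\<Sum>x\<in>UNIV. w x y) \<le> 1" and "c > 0"
  shows "card {xs \<in> nlists (length ys) UNIV. c \<le> prod_list (map2 w xs ys)} \<le> 1 / c"
proof -
  let ?L = "{xs \<in> nlists (length ys) UNIV. c \<le> prod_list (map2 w xs ys)}"
  have "card ?L * c = (\<Sum>xs\<in>?L. c)" by simp
  also have "\<dots> \<le> (\<Sum>xs\<in>?L. prod_list (map2 w xs ys))" by (intro sum_mono) auto
  also have "\<dots> \<le> (\<Sum>xs\<in>nlists (length ys) UNIV. prod_list (map2 w xs ys))"
    by (intro sum_mono2 finite_nlists_UNIV prod_list_nonneg) (auto simp: nonneg)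
  also have "\<dots> \<le> 1" by (rule sum_prod_list_nlists_le_1[OF nonneg le])
  finally show ?thesis using \<open>c > 0\<close> by (simp add: field_simps)
qed

section \<open>Conditional entropy as mean surprisal, and the typicality estimate\<close>

lemma log_prod_list:
  fixes xs :: "real list"
  assumes "\<And>x. x \<in> set xs \<Longrightarrow> x > 0"
  shows "prod_list xs > 0 \<and> log b (prod_list xs) = sum_list (map (log b) xs)"
  using assms by (induction xs) (auto simp: log_mult)

lemma cond_prob_pmf_nonneg: "cond_prob_pmf J x y \<ge> 0"
  by (simp add: cond_prob_pmf_def)

lemma sum_pmf_fst_eq:
  fixes J :: "('a :: finite \<times> 'b) pmf"
  shows "(\<Sum>x\<in>UNIV. pmf J (x, y)) = pmf (map_pmf snd J) y"
proof -
  have "pmf (map_pmf snd J) y = measure_pmf.prob J ((\<lambda>x. (x, y)) ` UNIV)"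
    by (auto simp: pmf_map intro!: arg_cong[of _ _ "measure_pmf.prob J"])
  also have "\<dots> = (\<Sum>x\<in>UNIV. pmf J (x, y))"
    by (subst measure_measure_pmf_finite) (auto simp: sum.reindex inj_on_def)
  finally show ?thesis ..
qed

lemma sum_cond_prob_pmf_le_1:
  fixes J :: "('a :: finite \<times> 'b) pmf"
  shows "(\<Sum>x\<in>UNIV. cond_prob_pmf J x y) \<le> 1"
  by (simp add: cond_prob_pmf_def sum_pmf_fst_eq flip: sum_divide_distrib)

lemma cond_prob_pmf_pos:
  assumes "(x, y) \<in> set_pmf J"
  shows "cond_prob_pmf J x y > 0"
  unfolding cond_prob_pmf_def using assms
  by (intro divide_pos_pos) (force intro: pmf_positive)+

lemma cond_prob_pmf_le_1:
  fixes J :: "('a :: finite \<times> 'b) pmf"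
  shows "cond_prob_pmf J x y \<le> 1"
  using member_le_sum[of x UNIV "\<lambda>x. cond_prob_pmf J x y"] sum_cond_prob_pmf_le_1[of J y]
  by (simp add: cond_prob_pmf_nonneg)

text \<open>This form, the mean of a function of one letter pair, is what the weak law
  needs.\<close>

lemma cond_entropy_pmf_eq_expectation:
  fixes J :: "('a :: finite \<times> 'b) pmf"
  assumes "finite Y" "set_pmf J \<subseteq> UNIV \<times> Y"
  shows "cond_entropy_pmf b UNIV Y J =
         measure_pmf.expectation J (\<lambda>z. - log b (cond_prob_pmf J (fst z) (snd z)))"
proof -
  have "measure_pmf.expectation J (\<lambda>z. - log b (cond_prob_pmf J (fst z) (snd z))) =
    (\<Sum>z\<in>UNIV \<times> Y. - log b (cond_prob_pmf J (fst z) (snd z)) * pmf J z)"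
    by (rule integral_measure_pmf_real) (use assms in auto)
  then show ?thesis
    by (simp add: cond_entropy_pmf_def case_prod_beta sum_negf mult.commute)
qed

lemma cond_entropy_pmf_nonneg:
  fixes J :: "('a :: finite \<times> 'b) pmf"
  assumes "b > 1"
  shows "cond_entropy_pmf b UNIV Y J \<ge> 0"
proof -
  have "pmf J (x, y) * log b (cond_prob_pmf J x y) \<le> 0" for x y
    using assms cond_prob_pmf_le_1[of J x y] cond_prob_pmf_pos[of x y J]
    by (cases "(x, y) \<in> set_pmf J") (simp_all add: mult_nonneg_nonpos set_pmf_iff)
  then show ?thesis
    by (auto simp: cond_entropy_pmf_def intro!: sum_nonpos)
qed

text \<open>Taking logarithms turns a small product of conditional probabilities into a large sum of
  surprisals, to which the weak law applies. The sum is centred at the entropy \<open>H\<close>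
  itself, while the threshold uses a possibly larger \<open>H'\<close>; this lets one threshold
  serve all decoders.\<close>

lemma prob_unlikely_word_le:
  fixes J :: "('a :: finite \<times> 'b) pmf" and b :: real
  assumes fin: "finite (set_pmf J)" and "b > 1" "\<gamma> > 0" "n > 0"
    and H: "measure_pmf.expectation J (\<lambda>z. - log b (cond_prob_pmf J (fst z) (snd z))) = H"
    and "H \<le> H'"
  shows "measure_pmf.prob (replicate_pmf n J)
      {zs. \<not> b powr (- real n * (H' + \<gamma>)) \<le>
             prod_list (map2 (cond_prob_pmf J) (map fst zs) (map snd zs))} \<le>
    measure_pmf.expectation J (\<lambda>z. (- log b (cond_prob_pmf J (fst z) (snd z)) - H)\<^sup>2) /
      (real n * \<gamma>\<^sup>2)"
proof -
  let ?w = "\<lambda>z. cond_prob_pmf J (fst z) (snd z)"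
  define h where "h z = - log b (?w z) - H" for z
  have mean: "measure_pmf.expectation J h = 0"
    unfolding h_def using H integrable_measure_pmf_finite[OF fin, of "\<lambda>z. log b (?w z)"]
    by simp
  have "measure_pmf.prob (replicate_pmf n J)
      {zs. \<not> b powr (- real n * (H' + \<gamma>)) \<le>
             prod_list (map2 (cond_prob_pmf J) (map fst zs) (map snd zs))} \<le>
    measure_pmf.prob (replicate_pmf n J) {zs. sum_list (map h zs) \<ge> real n * \<gamma>}"
  \<comment> \<open>The inclusion is checked on the support only, where every factor is positive and
    the logarithm of the product is the sum of the logarithms.\<close>
  proof (rule measure_pmf.finite_measure_mono_AE, unfold AE_measure_pmf_iff, intro ballI impI)
    fix zs assume zs: "zs \<in> set_pmf (replicate_pmf n J)"
      and "zs \<in> {zs. \<not> b powr (- real n * (H' + \<gamma>)) \<le>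
             prod_list (map2 (cond_prob_pmf J) (map fst zs) (map snd zs))}"
    moreover have "map2 (cond_prob_pmf J) (map fst zs) (map snd zs) = map ?w zs"
      by (induction zs) auto
    ultimately have less: "prod_list (map ?w zs) < b powr (- real n * (H' + \<gamma>))" by simp
    have len: "length zs = n" and supp: "set zs \<subseteq> set_pmf J"
      using zs by (auto simp: set_replicate_pmf)
    have lp: "prod_list (map ?w zs) > 0 \<and>
        log b (prod_list (map ?w zs)) = sum_list (map (log b) (map ?w zs))"
      by (rule log_prod_list) (use supp in \<open>auto intro!: cond_prob_pmf_pos\<close>)
    have "log b (prod_list (map ?w zs)) < - real n * (H' + \<gamma>)"
      using less lp log_less_iff[OF \<open>b > 1\<close>] by blast
    moreover have "sum_list (map h zs) = - sum_list (map (log b) (map ?w zs)) - length zs * H"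
      by (induction zs) (simp_all add: h_def algebra_simps)
    moreover have "real n * H \<le> real n * H'" using \<open>H \<le> H'\<close> by (simp add: mult_left_mono)
    ultimately show "zs \<in> {zs. sum_list (map h zs) \<ge> real n * \<gamma>}"
      using lp by (simp add: len algebra_simps)
  qed auto
  also have "\<dots> \<le> measure_pmf.expectation J (\<lambda>z. (h z)\<^sup>2) / (real n * \<gamma>\<^sup>2)"
    by (rule replicate_pmf_weak_law[OF fin mean]) fact+
  finally show ?thesis unfolding h_def .
qed

section \<open>The source coding theorem\<close>

text \<open>Decoder \<open>k\<close> involves only the pair of the source and its own side
  information, and projecting letter by letter commutes with taking independent copies. Splitting
  the list of pairs into a pair of words gives the shape required by
  \<open>expected_binning_error\<close>.\<close>

lemma decoding_error_law_X_Y: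
  "decoding_error P n f g k =
     measure_pmf.prob (map_pmf (\<lambda>zs. (map fst zs, map snd zs)) (replicate_pmf n (law_X_Y k P)))
       {z. g (f (fst z), snd z) \<noteq> fst z}"
proof -
  have "(\<lambda>(x, y). y k) = (\<lambda>z :: 'a \<times> (nat \<Rightarrow> 'b). snd z k)" by auto
  then show ?thesis
    unfolding decoding_error_def law_X_Y_def map_replicate_pmf[symmetric]
    by (simp add: map_pmf_comp vimage_def case_prod_beta o_def eq_commute)
qed

theorem mainTheorem1:
  fixes P :: "('x :: {field, finite} \<times> (nat \<Rightarrow> 'y)) pmf"
    and \<Y> :: "nat \<Rightarrow> 'y set"
    and K q :: nat
    and \<epsilon> \<delta> :: real
  assumes "q = CARD('x)"
    and "K \<ge> 1"
    and "\<And>k. k \<in> {1..K} \<Longrightarrow> finite (\<Y> k)"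
    and "joint_law_on K \<Y> P"
    and "\<epsilon> > 0" and "\<delta> > 0"
  shows "\<exists>(t::nat) (m0::nat). t > 0 \<and> m0 > 0 \<and>
    (\<forall>m n. m \<ge> m0 \<longrightarrow> n = t * 2 ^ m \<longrightarrow>
      (\<exists>(R::real) (l::nat) (f :: 'x list \<Rightarrow> 'x list) (g :: nat \<Rightarrow> 'x list \<times> 'y list \<Rightarrow> 'x list).
         real l = real n * R \<and>
         f \<in> nlists n UNIV \<rightarrow> nlists l UNIV \<and>
         (\<forall>k\<in>{1..K}. g k \<in> nlists l UNIV \<times> nlists n (\<Y> k) \<rightarrow> nlists n UNIV) \<and>
         0 < R - Max ((\<lambda>k. cond_entropy_pmf (real q) UNIV (\<Y> k) (law_X_Y k P)) ` {1..K}) \<and>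
         R - Max ((\<lambda>k. cond_entropy_pmf (real q) UNIV (\<Y> k) (law_X_Y k P)) ` {1..K}) < \<delta> \<and>
         (\<forall>k\<in>{1..K}. decoding_error P n f (g k) k < \<epsilon>)))"
proof -
  define J where "J k = law_X_Y k P" for k
  define h where "h k = cond_entropy_pmf (real q) UNIV (\<Y> k) (J k)" for k
  define H where "H = Max (h ` {1..K})"
  \<comment> \<open>The rate will exceed \<open>H\<close> by at least \<open>2 * \<gamma>\<close>
    and the typicality exponent by only \<open>\<gamma>\<close>; the remaining
    \<open>\<gamma>\<close> makes collisions rare.\<close>
  define \<gamma> where "\<gamma> = \<delta> / 4"
  define V where "V k = measure_pmf.expectation (J k)
      (\<lambda>z. (- log (real q) (cond_prob_pmf (J k) (fst z) (snd z)) - h k)\<^sup>2)" for k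
  have \<gamma>: "\<gamma> > 0" using \<open>\<delta> > 0\<close> by (simp add: \<gamma>_def)
  \<comment> \<open>A field contains distinct 0 and 1, so \<open>q\<close> is a proper base for
    logarithms.\<close>
  have "card {0, 1 :: 'x} \<le> CARD('x)" by (rule card_mono) auto
  then have q: "real q > 1" using assms(1) by simp
  have supp: "set_pmf (J k) \<subseteq> UNIV \<times> \<Y> k" if "k \<in> {1..K}" for k
    using assms(4) that unfolding J_def law_X_Y_def joint_law_on_def by fastforce
  have finJ: "finite (set_pmf (J k))" if "k \<in> {1..K}" for k
    by (rule finite_subset[OF supp[OF that]]) (simp add: assms(3)[OF that])
  have h_exp: "measure_pmf.expectation (J k)
      (\<lambda>z. - log (real q) (cond_prob_pmf (J k) (fst z) (snd z))) = h k" if "k \<in> {1..K}" for k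
    unfolding h_def using cond_entropy_pmf_eq_expectation[OF assms(3) supp] that by simp
  have h_le: "h k \<le> H" if "k \<in> {1..K}" for k
    unfolding H_def using that by (intro Max_ge) auto
  have "0 \<le> h 1" unfolding h_def by (rule cond_entropy_pmf_nonneg[OF q])
  then have H0: "H \<ge> 0" using h_le[of 1] \<open>K \<ge> 1\<close> by simp

  \<comment> \<open>Choice of the block length\<close>
  let ?bound = "\<lambda>n::nat. \<Sum>k\<in>{1..K}. V k / (real n * \<gamma>\<^sup>2) + real q powr (- real n * \<gamma>)"
  \<comment> \<open>The first summand bounds the chance that the source word misses the threshold,
    the second the chance of a collision.\<close>
  have "(\<lambda>n. V k / (real n * \<gamma>\<^sup>2) + real q powr (- real n * \<gamma>)) \<longlonglongrightarrow> 0" for k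
  proof -
    have "(\<lambda>n. V k / \<gamma>\<^sup>2 * (1 / real n)) \<longlonglongrightarrow> V k / \<gamma>\<^sup>2 * 0"
      by (intro tendsto_mult tendsto_const lim_1_over_n)
    moreover have "(\<lambda>n. (real q powr (- \<gamma>)) ^ n) \<longlonglongrightarrow> 0"
      using q \<gamma> by (intro LIMSEQ_power_zero) (simp add: powr_less_one)
    moreover have "(real q powr (- \<gamma>)) ^ n = real q powr (- real n * \<gamma>)" for n
      using q by (simp add: powr_powr mult.commute flip: powr_realpow)
    ultimately show ?thesis
      using tendsto_add[of "\<lambda>n. V k / \<gamma>\<^sup>2 * (1 / real n)" 0 sequentially
          "\<lambda>n. (real q powr (- \<gamma>)) ^ n" 0] by (simp add: mult.commute)
  qed
  then have "?bound \<longlonglongrightarrow> (\<Sum>k\<in>{1..K}. 0)" by (intro tendsto_sum)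
  then have "eventually (\<lambda>n. ?bound n < \<epsilon>) sequentially"
    using \<open>\<epsilon> > 0\<close> by (intro order_tendstoD(2)[of _ 0]) simp_all
  \<comment> \<open>Rounding the code length up to an integer then costs less than
    \<open>\<delta> / 2\<close> in rate.\<close>
  moreover have "eventually (\<lambda>n. real n > 2 / \<delta>) sequentially"
    by (rule eventually_compose_filterlim[OF eventually_gt_at_top filterlim_real_sequentially])
  ultimately have "eventually (\<lambda>n. ?bound n < \<epsilon> \<and> real n > 2 / \<delta>) sequentially"
    by (rule eventually_conj)
  then obtain n0 where n0: "\<And>n. n \<ge> n0 \<Longrightarrow> ?bound n < \<epsilon> \<and> real n > 2 / \<delta>"
    unfolding eventually_sequentially by blast

  \<comment> \<open>One code for all decoders at a given large block length\<close>
  have code: "\<exists>(R::real) (l::nat) (f :: 'x list \<Rightarrow> 'x list) (g :: nat \<Rightarrow> 'x list \<times> 'y list \<Rightarrow> 'x list).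
         real l = real n * R \<and>
         f \<in> nlists n UNIV \<rightarrow> nlists l UNIV \<and>
         (\<forall>k\<in>{1..K}. g k \<in> nlists l UNIV \<times> nlists n (\<Y> k) \<rightarrow> nlists n UNIV) \<and>
         0 < R - H \<and> R - H < \<delta> \<and>
         (\<forall>k\<in>{1..K}. decoding_error P n f (g k) k < \<epsilon>)" if "n \<ge> n0" for n
  proof -
    have small: "?bound n < \<epsilon>" and large: "real n > 2 / \<delta>" using n0[OF that] by auto
    have "0 < 2 / \<delta>" using \<open>\<delta> > 0\<close> by simp
    then have n: "n > 0" using large by linarith
    \<comment> \<open>Aiming at the middle of the allowed interval leaves room on both sides: the
      rate stays above \<open>H\<close>, and rounding up keeps it below \<open>H + \<delta>\<close>.
      Since \<open>H\<close> is nonnegative, \<open>nat\<close> truncates nothing.\<close>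
    define l where "l = nat \<lceil>real n * (H + \<delta> / 2)\<rceil>"
    define R where "R = real l / real n"
    have "real n * (H + \<delta> / 2) \<ge> 0" using H0 \<open>\<delta> > 0\<close> by simp
    then have l: "real n * (H + \<delta> / 2) \<le> real l" "real l < real n * (H + \<delta> / 2) + 1"
      unfolding l_def by linarith+
    have R_lower: "0 < R - H"
    proof -
      have "real n * H < real n * (H + \<delta> / 2)" using n \<open>\<delta> > 0\<close> by simp
      then show ?thesis using l n by (simp add: R_def field_simps)
    qed
    have R_upper: "R - H < \<delta>"
    proof -
      have "1 < real n * (\<delta> / 2)" using large \<open>\<delta> > 0\<close> by (simp add: field_simps)
      then have "real l < real n * (H + \<delta>)" using l by (simp add: algebra_simps)
      then show ?thesis using n by (simp add: R_def field_simps)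
    qed

    define c where "c = real q powr (- real n * (H + \<gamma>))"
    define T where "T k = (\<lambda>xs ys. c \<le> prod_list (map2 (cond_prob_pmf (J k)) xs ys))" for k
    define A where "A = nlists n (UNIV :: 'x set)"
    define B where "B = nlists l (UNIV :: 'x set)"
    define Q where "Q k = map_pmf (\<lambda>zs. (map fst zs, map snd zs)) (replicate_pmf n (J k))" for k
    define d where "d = replicate n (0 :: 'x)"
    define err where "err f k =
        measure_pmf.prob (Q k) {z. bin_decode A d (T k) f (f (fst z)) (snd z) \<noteq> fst z}"
      for f :: "'x list \<Rightarrow> 'x list" and k
    \<comment> \<open>The value \<open>[]\<close> is a dummy colour for lists outside
      \<open>A\<close>, that is, of length other than \<open>n\<close>.\<close>
    let ?F = "Pi_pmf A [] (\<lambda>_. pmf_of_set B)"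
    have c: "c > 0" using q by (simp add: c_def)
    have AB: "finite A" "finite B" "B \<noteq> {}" "d \<in> A"
      by (auto simp: A_def B_def d_def finite_nlists_UNIV nlists_not_empty in_nlists_UNIV
          intro: nlists_replicateI)
    have setF: "set_pmf ?F = PiE_dflt A [] (\<lambda>_. B)"
      using AB by (simp add: set_Pi_pmf o_def)
    have finF: "finite (set_pmf ?F)"
      unfolding setF using AB by (intro finite_PiE_dflt) auto
    \<comment> \<open>At most \<open>1 / c\<close>, which is
      \<open>q powr (n * (H + \<gamma>))\<close>, words are plausible, against at least
      \<open>q powr (n * (H + 2 * \<gamma>))\<close> colours.\<close>
    have ratio: "1 / c / card B \<le> real q powr (- real n * \<gamma>)"
    proof -
      have "1 / c / card B = real q powr (real n * (H + \<gamma>) - real l)"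
        using q by (simp add: c_def B_def card_nlists_UNIV powr_minus powr_diff powr_realpow
            flip: assms(1)) (simp add: field_simps)
      also have "\<dots> \<le> real q powr (- real n * \<gamma>)"
        using l q by (intro powr_mono) (auto simp: \<gamma>_def algebra_simps)
      finally show ?thesis .
    qed
    have err_bound: "measure_pmf.expectation ?F (\<lambda>f. err f k) \<le>
        V k / (real n * \<gamma>\<^sup>2) + real q powr (- real n * \<gamma>)" if k: "k \<in> {1..K}" for k
    proof -
      have len: "length zs = n" if "zs \<in> set_pmf (replicate_pmf n (J k))" for zs
        using that by (simp add: set_replicate_pmf)
      have "measure_pmf.expectation ?F (\<lambda>f. err f k) \<le>
          measure_pmf.prob (Q k) {z. \<not> T k (fst z) (snd z)} + (1 / c) / card B"
        unfolding err_def
      proof (rule expected_binning_error)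
        show "finite (set_pmf (Q k))"
          using finite_set_replicate_pmf[OF finJ[OF k]] by (simp add: Q_def)
        show "fst ` set_pmf (Q k) \<subseteq> A"
          unfolding Q_def A_def by (auto simp: in_nlists_UNIV len)
        \<comment> \<open>Side information in the support has length \<open>n\<close>, matching the
          words in \<open>A\<close> as the counting bound requires.\<close>
        show "card {x \<in> A. T k x y} \<le> 1 / c" if "y \<in> snd ` set_pmf (Q k)" for y
        proof -
          have "length y = n" using that by (auto simp: Q_def len)
          then show ?thesis
            using card_likely_words_le[of "cond_prob_pmf (J k)", OF cond_prob_pmf_nonneg
                sum_cond_prob_pmf_le_1 c, of y]
            by (simp add: A_def T_def)
        qed
      qed (use AB in auto)
      also have "measure_pmf.prob (Q k) {z. \<not> T k (fst z) (snd z)} \<le> V k / (real n * \<gamma>\<^sup>2)"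
        using prob_unlikely_word_le[OF finJ[OF k] q \<gamma> n h_exp[OF k] h_le[OF k]]
        by (simp add: Q_def T_def c_def V_def vimage_def)
      finally show ?thesis using ratio by linarith
    qed
    \<comment> \<open>Averaging the sum of the errors yields one colouring good for every decoder at
      once, since each nonnegative error is at most the sum.\<close>
    have "measure_pmf.expectation ?F (\<lambda>f. \<Sum>k\<in>{1..K}. err f k) =
        (\<Sum>k\<in>{1..K}. measure_pmf.expectation ?F (\<lambda>f. err f k))"
      by (intro Bochner_Integration.integral_sum integrable_measure_pmf_finite finF)
    also have "\<dots> \<le> ?bound n" by (intro sum_mono err_bound)
    also have "\<dots> < \<epsilon>" by (rule small)
    finally obtain f where f: "f \<in> set_pmf ?F" "(\<Sum>k\<in>{1..K}. err f k) < \<epsilon>"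
      using ex_less_of_expectation_less[OF finF] by blast
    define g where "g k = (\<lambda>(s, ys). bin_decode A d (T k) f s ys)" for k
    have "decoding_error P n f (g k) k < \<epsilon>" if "k \<in> {1..K}" for k
    proof -
      have "decoding_error P n f (g k) k = err f k"
        by (simp add: decoding_error_law_X_Y err_def Q_def J_def g_def)
      also have "\<dots> \<le> (\<Sum>k\<in>{1..K}. err f k)"
        using that by (intro member_le_sum) (auto simp: err_def)
      finally show ?thesis using f(2) by simp
    qed
    moreover have "f \<in> nlists n UNIV \<rightarrow> nlists l UNIV"
      using f(1) unfolding setF by (auto simp: PiE_dflt_def A_def B_def)
    moreover have "g k \<in> nlists l UNIV \<times> nlists n (\<Y> k) \<rightarrow> nlists n UNIV" for k
      using bin_decode_in[OF AB(4)] by (auto simp: g_def A_def)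
    moreover have "real l = real n * R" using n by (simp add: R_def)
    ultimately show ?thesis using R_lower R_upper
      by (intro exI[of _ R] exI[of _ l] exI[of _ f] exI[of _ g]) simp
  qed
  have H_eq: "Max ((\<lambda>k. cond_entropy_pmf (real q) UNIV (\<Y> k) (law_X_Y k P)) ` {1..K}) = H"
    unfolding H_def h_def[abs_def] J_def ..
  \<comment> \<open>With \<open>t = 1\<close>, the bound \<open>m < 2 ^ m\<close> carries
    \<open>m\<close> past \<open>n0\<close>; taking \<open>Suc n0\<close> for \<open>m0\<close>
    makes it positive.\<close>
  have "n0 \<le> n" if "m \<ge> Suc n0" "n = 1 * 2 ^ m" for m n :: nat
    using that less_exp[of m] by linarith
  then show ?thesis
    unfolding H_eq by (intro exI[of _ 1] exI[of _ "Suc n0"] conjI allI impI code) auto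
qed

end
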